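(* Let $K$ be a field, let $t,n$ be positive integers, let $R=K[x_1,\dots,x_n]$, and let $I_t(L_n)$ be the ideal of $R$ generated by the monomials $x_ix_{i+1}\cdots x_{i+t-1}$ for $i=1,\dots,n-t+1$. Then $$\operatorname{ara}(I_t(L_n))=\begin{cases}\dfrac{2(n-d)}{t+1} & \text{if } n\equiv d \pmod{t+1}\text{ with } 0\le d\le t-1,\\[2mm] \dfrac{2n-(t-1)}{t+1} & \text{if } n\equiv t \pmod{t+1}.\end{cases}$$
   Context: For an ideal $I$ of a commutative noetherian ring $R$ with identity, the arithmetical rank $\operatorname{ara} I$ is the minimum number of elements of $R$ that generate an ideal having the same radical as $I$ (the zero ideal is generated by $0$ elements). If $n<t$, the generating set of $I_t(L_n)$ is empty and $I_t(L_n)=0$. *)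

theory Defs
  imports
    Complex_Main
    "HOL-Algebra.Ideal"
    "HOL-Library.Poly_Mapping"
    "HOL-Number_Theory.Cong"
begin

definition radical :: "('a, 'b) ring_scheme \<Rightarrow> 'a set \<Rightarrow> 'a set" where
  "radical R I = {x \<in> carrier R. \<exists>k::nat. x [^]\<^bsub>R\<^esub> k \<in> I}"

text \<open>The ideal generated by the empty set is the zero ideal. In a noetherian ring the set of
  admissible \<open>m\<close> is nonempty for every ideal, so the minimum exists.\<close>

definition arithmetical_rank :: "('a, 'b) ring_scheme \<Rightarrow> 'a set \<Rightarrow> nat" where
  "arithmetical_rank R I =
     (LEAST m. \<exists>S \<subseteq> carrier R. finite S \<and> card S = m \<and> radical R (Idl\<^bsub>R\<^esub> S) = radical R I)"

text \<open>A monomial is a finitely supported exponent vector, and a polynomial is a finitely supported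
  function from monomials to coefficients; the product on the type is the convolution product.
  The variables are indexed by all natural numbers, and the polynomial ring in
  \<open>x\<^sub>1, \<dots>, x\<^sub>n\<close> is cut out as a carrier set.\<close>

type_synonym 'k mpoly = "(nat \<Rightarrow>\<^sub>0 nat) \<Rightarrow>\<^sub>0 'k"

definition var :: "nat \<Rightarrow> 'k::comm_ring_1 mpoly" where
  "var i = Poly_Mapping.single (Poly_Mapping.single i 1) 1"

definition mpoly_ring :: "nat \<Rightarrow> 'k::comm_ring_1 mpoly ring" where
  "mpoly_ring n =
     \<lparr>carrier = {p. \<forall>m \<in> Poly_Mapping.keys p. Poly_Mapping.keys m \<subseteq> {1..n}},
      monoid.mult = (*), one = 1, ring.zero = 0, add = (+)\<rparr>"

text \<open>The condition \<open>i + t \<le> n + 1\<close> is \<open>i \<le> n - t + 1\<close> without truncated subtraction.\<close>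

definition path_ideal :: "nat \<Rightarrow> nat \<Rightarrow> 'k::comm_ring_1 mpoly set" where
  "path_ideal t n =
     Idl\<^bsub>mpoly_ring n\<^esub> {(\<Prod>j\<in>{i..<i + t}. var j) | i. 1 \<le> i \<and> i + t \<le> n + 1}"

lemma mpoly_ring_closed:
  fixes p q :: "'k::comm_ring_1 mpoly"
  assumes "p \<in> carrier (mpoly_ring n)" "q \<in> carrier (mpoly_ring n)"
  shows "p + q \<in> carrier (mpoly_ring n)"
    and "p * q \<in> carrier (mpoly_ring n)"
    and "- p \<in> carrier (mpoly_ring n)"
proof -
  show "p + q \<in> carrier (mpoly_ring n)"
    using assms Poly_Mapping.keys_add[of p q] by (auto simp: mpoly_ring_def)
  show "p * q \<in> carrier (mpoly_ring n)"
  proof -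
    have "Poly_Mapping.keys m \<subseteq> {1..n}" if m: "m \<in> Poly_Mapping.keys (p * q)" for m
    proof -
      obtain a b where ab: "m = a + b" "a \<in> Poly_Mapping.keys p" "b \<in> Poly_Mapping.keys q"
        using m keys_mult[of p q] by blast
      have "Poly_Mapping.keys a \<subseteq> {1..n}" "Poly_Mapping.keys b \<subseteq> {1..n}"
        using ab(2,3) assms by (auto simp: mpoly_ring_def)
      then show ?thesis
        using Poly_Mapping.keys_add[of a b] ab(1) by blast
    qed
    then show ?thesis by (simp add: mpoly_ring_def)
  qed
  show "- p \<in> carrier (mpoly_ring n)"
  proof -
    have "Poly_Mapping.keys (- p) = Poly_Mapping.keys p"
      by transfer simp
    then show ?thesis
      using assms(1) by (simp add: mpoly_ring_def)
  qed
qed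

lemma cring_mpoly_ring: "cring (mpoly_ring n :: 'k::comm_ring_1 mpoly ring)"
proof (intro cringI abelian_groupI comm_monoidI)
  fix x :: "'k mpoly" assume x: "x \<in> carrier (mpoly_ring n)"
  show "\<exists>y\<in>carrier (mpoly_ring n). y \<oplus>\<^bsub>mpoly_ring n\<^esub> x = \<zero>\<^bsub>mpoly_ring n\<^esub>"
    using mpoly_ring_closed(3)[OF x x] by (intro bexI[of _ "- x"]) (simp_all add: mpoly_ring_def)
next
  fix x y :: "'k mpoly" assume xy: "x \<in> carrier (mpoly_ring n)" "y \<in> carrier (mpoly_ring n)"
  show "x \<oplus>\<^bsub>mpoly_ring n\<^esub> y \<in> carrier (mpoly_ring n)"
    using mpoly_ring_closed(1)[OF xy] by (simp add: mpoly_ring_def)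
  show "x \<otimes>\<^bsub>mpoly_ring n\<^esub> y \<in> carrier (mpoly_ring n)"
    using mpoly_ring_closed(2)[OF xy] by (simp add: mpoly_ring_def)
qed (auto simp: mpoly_ring_def algebra_simps)

lemma var_in_carrier: "1 \<le> i \<Longrightarrow> i \<le> n \<Longrightarrow> var i \<in> carrier (mpoly_ring n)"
  by (simp add: var_def mpoly_ring_def)

lemma prod_var_in_carrier:
  assumes "1 \<le> i" "i + t \<le> n + 1"
  shows "(\<Prod>j\<in>{i..<i + t}. var j) \<in> carrier (mpoly_ring n :: 'k::comm_ring_1 mpoly ring)"
proof -
  have "(\<Prod>j\<in>A. var j) \<in> carrier (mpoly_ring n :: 'k mpoly ring)"
    if "finite A" "A \<subseteq> {1..n}" for A
    using that
  proof (induction A rule: finite_induct)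
    case empty
    then show ?case by (simp add: mpoly_ring_def)
  next
    case (insert a A)
    have "(var a :: 'k mpoly) \<in> carrier (mpoly_ring n)"
      using insert.prems by (intro var_in_carrier) auto
    moreover have "(\<Prod>j\<in>A. var j) \<in> carrier (mpoly_ring n :: 'k mpoly ring)"
      using insert by simp
    ultimately have "var a * (\<Prod>j\<in>A. var j) \<in> carrier (mpoly_ring n :: 'k mpoly ring)"
      by (rule mpoly_ring_closed(2))
    then show ?case
      unfolding prod.insert[OF insert.hyps] .
  qed
  moreover have "{i..<i + t} \<subseteq> {1..n}"
    using assms by (simp add: subset_iff)
  ultimately show ?thesis by blast
qed

lemma ideal_path_ideal: "ideal (path_ideal t n) (mpoly_ring n :: 'k::comm_ring_1 mpoly ring)"
  unfolding path_ideal_def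
proof (rule ring.genideal_ideal[OF cring.axioms(1)[OF cring_mpoly_ring]], rule subsetI)
  fix p :: "'k mpoly"
  assume "p \<in> {(\<Prod>j\<in>{i..<i + t}. var j) | i. 1 \<le> i \<and> i + t \<le> n + 1}"
  then obtain i where "p = (\<Prod>j\<in>{i..<i + t}. var j)" "1 \<le> i" "i + t \<le> n + 1"
    by blast
  then show "p \<in> carrier (mpoly_ring n)"
    by (simp only: prod_var_in_carrier)
qed

end

theory Submission
  imports Defs
begin

text \<open>Write \<open>n = k (t + 1) + d\<close> with \<open>0 \<le> d \<le> t\<close>. The claim is that the arithmetical rank is \<open>2 k\<close> for \<open>d < t\<close>
  and \<open>2 k + 1\<close> for \<open>d = t\<close>.

  For the lower bound, set all variables to \<open>1\<close> except those whose index is congruent to \<open>0\<close> or \<open>1\<close>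
  modulo \<open>t + 1\<close> (for \<open>d < t\<close> the index \<open>k (t + 1) + 1\<close> is dropped as well). Every window of \<open>t\<close>
  consecutive indices meets the remaining ones, and each of the remaining ones is the only one in some
  window. So the path ideal becomes the ideal generated by the remaining variables, of which there
  are \<open>2 k\<close> or \<open>2 k + 1\<close>. An ideal generated by \<open>m\<close> variables is not the radical of an ideal with fewer
  than \<open>m\<close> generators. This is an instance of Krull's height theorem, proved in
  \<open>card_variables_le\<close> by comparing the growth of dimensions, and transported to the path ideal by
  \<open>card_le_of_specialized_variables\<close>.

  For the upper bound, any run of at most \<open>t + 1\<close> consecutive path monomials is generated up to radical
  by two elements (\<open>consecutive_two_elements\<close>). Such a run is, up to a common factor, a string
  \<open>a\<^sub>1 \<dots> a\<^sub>s, b\<^sub>1 a\<^sub>2 \<dots> a\<^sub>s, \<dots>, b\<^sub>1 \<dots> b\<^sub>s\<close>, and the two elements are built by recursion on \<open>s\<close> in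
  \<open>string_two_elements\<close>. There are \<open>n - t + 1\<close> path monomials, which is at most \<open>k (t + 1)\<close> if
  \<open>d < t\<close> and \<open>k (t + 1) + 1\<close> if \<open>d = t\<close>, so cutting them into \<open>k\<close> runs gives \<open>2 k\<close> elements and, in the
  second case, one monomial is left over.\<close>

section \<open>Setting variables to one\<close>

definition restrict_exponent :: "nat set \<Rightarrow> (nat \<Rightarrow>\<^sub>0 nat) \<Rightarrow> (nat \<Rightarrow>\<^sub>0 nat)" where
  "restrict_exponent Y m = Poly_Mapping.mapp (\<lambda>i v. if i \<in> Y then v else 0) m"

lemma lookup_restrict_exponent:
  "Poly_Mapping.lookup (restrict_exponent Y m) i = (if i \<in> Y then Poly_Mapping.lookup m i else 0)"
  by (simp add: restrict_exponent_def lookup_mapp when_def in_keys_iff)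

lemma restrict_exponent_add:
  "restrict_exponent Y (m + m') = restrict_exponent Y m + restrict_exponent Y m'"
  by (rule poly_mapping_eqI) (simp add: lookup_restrict_exponent lookup_add)

lemma restrict_exponent_zero [simp]: "restrict_exponent Y 0 = 0"
  by (rule poly_mapping_eqI) (simp add: lookup_restrict_exponent)

lemma keys_restrict_exponent: "Poly_Mapping.keys (restrict_exponent Y m) \<subseteq> Y"
  by (auto simp: in_keys_iff lookup_restrict_exponent split: if_splits)

lemma poly_mapping_sum_singles:
  fixes p :: "'a \<Rightarrow>\<^sub>0 'b::comm_monoid_add"
  shows "p = (\<Sum>m\<in>Poly_Mapping.keys p. Poly_Mapping.single m (Poly_Mapping.lookup p m))"
proof (rule poly_mapping_eqI)
  fix k
  have "Poly_Mapping.lookup (\<Sum>m\<in>Poly_Mapping.keys p. Poly_Mapping.single m (Poly_Mapping.lookup p m)) k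
      = (\<Sum>m\<in>Poly_Mapping.keys p. if m = k then Poly_Mapping.lookup p m else 0)"
    by (simp add: lookup_sum lookup_single when_def)
  also have "\<dots> = Poly_Mapping.lookup p k"
    by (simp add: in_keys_iff)
  finally show "Poly_Mapping.lookup p k = Poly_Mapping.lookup (\<Sum>m\<in>Poly_Mapping.keys p. Poly_Mapping.single m (Poly_Mapping.lookup p m)) k" ..
qed

lemma mult_sum_singles:
  fixes p q :: "'k::comm_ring_1 mpoly"
  shows "p * q = (\<Sum>a\<in>Poly_Mapping.keys p. \<Sum>b\<in>Poly_Mapping.keys q.
           Poly_Mapping.single (a + b) (Poly_Mapping.lookup p a * Poly_Mapping.lookup q b))"
  by (subst poly_mapping_sum_singles[of p], subst poly_mapping_sum_singles[of q])
    (simp add: sum_product mult_single)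

text \<open>Specialization substitutes \<open>1\<close> for every variable whose index lies outside \<open>Y\<close>. On monomials it
  deletes the exponents outside \<open>Y\<close>; several monomials may become equal, so their coefficients are
  added up.\<close>
definition specialize :: "nat set \<Rightarrow> 'k::comm_ring_1 mpoly \<Rightarrow> 'k mpoly" where
  "specialize Y p = (\<Sum>m\<in>Poly_Mapping.keys p. Poly_Mapping.single (restrict_exponent Y m) (Poly_Mapping.lookup p m))"

text \<open>Summing over a larger set of monomials makes additivity immediate: a common set of monomials
  serves both summands and their sum.\<close>
lemma specialize_superset:
  assumes "finite A" "Poly_Mapping.keys p \<subseteq> A"
  shows "specialize Y p = (\<Sum>m\<in>A. Poly_Mapping.single (restrict_exponent Y m) (Poly_Mapping.lookup p m))"
  unfolding specialize_def using assms by (intro sum.mono_neutral_left) (auto simp: in_keys_iff)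

lemma specialize_zero [simp]: "specialize Y 0 = 0"
  by (simp add: specialize_def)

lemma specialize_add: "specialize Y (p + q) = specialize Y p + specialize Y q"
proof -
  let ?A = "Poly_Mapping.keys p \<union> Poly_Mapping.keys q"
  have "specialize Y (p + q) = (\<Sum>m\<in>?A. Poly_Mapping.single (restrict_exponent Y m) (Poly_Mapping.lookup (p + q) m))"
    using Poly_Mapping.keys_add[of p q] by (intro specialize_superset) auto
  also have "\<dots> = specialize Y p + specialize Y q"
    by (simp add: lookup_add single_add sum.distrib specialize_superset[of ?A])
  finally show ?thesis .
qed

lemma specialize_sum: "specialize Y (sum f A) = (\<Sum>x\<in>A. specialize Y (f x))"
  by (induction A rule: infinite_finite_induct) (simp_all add: specialize_add)

lemma specialize_single:
  "specialize Y (Poly_Mapping.single m c) = Poly_Mapping.single (restrict_exponent Y m) c"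
  by (subst specialize_superset[of "{m}"]) auto

lemma specialize_mult: "specialize Y (p * q) = specialize Y p * specialize Y q"
proof -
  have "specialize Y (p * q) = (\<Sum>a\<in>Poly_Mapping.keys p. \<Sum>b\<in>Poly_Mapping.keys q.
      Poly_Mapping.single (restrict_exponent Y a) (Poly_Mapping.lookup p a)
      * Poly_Mapping.single (restrict_exponent Y b) (Poly_Mapping.lookup q b))"
    by (subst mult_sum_singles) (simp add: specialize_sum specialize_single restrict_exponent_add mult_single)
  then show ?thesis
    by (simp add: specialize_def sum_product)
qed

lemma specialize_one [simp]: "specialize Y 1 = 1"
  using specialize_single[of Y 0 1] by simp

lemma specialize_power: "specialize Y (p ^ k) = specialize Y p ^ k"
  by (induction k) (simp_all add: specialize_mult)

lemma specialize_prod: "specialize Y (prod f A) = (\<Prod>x\<in>A. specialize Y (f x))"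
  by (induction A rule: infinite_finite_induct) (simp_all add: specialize_mult)

lemma specialize_var: "specialize Y (var i) = (if i \<in> Y then var i else 1)"
proof -
  have "restrict_exponent Y (Poly_Mapping.single i 1) = (if i \<in> Y then Poly_Mapping.single i 1 else 0)"
    by (rule poly_mapping_eqI) (auto simp: lookup_restrict_exponent lookup_single when_def)
  then show ?thesis
    by (simp add: var_def specialize_single)
qed

lemma exponent_add_eq_zero_iff: "a + b = 0 \<longleftrightarrow> a = 0 \<and> b = (0 :: nat \<Rightarrow>\<^sub>0 nat)"
  by (auto simp: poly_mapping_eq_iff lookup_add fun_eq_iff)

text \<open>Exponents cannot cancel, so only the constant terms contribute to a constant term: taking the
  value at the origin is multiplicative.\<close>
lemma lookup_mult_zero:
  fixes p q :: "'k::comm_ring_1 mpoly"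
  shows "Poly_Mapping.lookup (p * q) 0 = Poly_Mapping.lookup p 0 * Poly_Mapping.lookup q 0"
proof -
  have "Poly_Mapping.lookup (p * q) 0 = (\<Sum>a\<in>Poly_Mapping.keys p. \<Sum>b\<in>Poly_Mapping.keys q.
      (if a = 0 then Poly_Mapping.lookup p a else 0) * (if b = 0 then Poly_Mapping.lookup q b else 0))"
    by (subst mult_sum_singles)
      (auto simp: lookup_sum lookup_single when_def exponent_add_eq_zero_iff intro!: sum.cong)
  also have "\<dots> = Poly_Mapping.lookup p 0 * Poly_Mapping.lookup q 0"
    by (simp add: sum_product[symmetric] in_keys_iff)
  finally show ?thesis .
qed

lemma lookup_power_zero:
  fixes p :: "'k::comm_ring_1 mpoly"
  shows "Poly_Mapping.lookup (p ^ k) 0 = Poly_Mapping.lookup p 0 ^ k"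
  by (induction k) (simp_all add: lookup_mult_zero)

section \<open>The ideal of the origin needs as many elements as variables\<close>

definition polys_in :: "nat set \<Rightarrow> 'k::comm_ring_1 mpoly set" where
  "polys_in Y = {p. \<forall>m \<in> Poly_Mapping.keys p. Poly_Mapping.keys m \<subseteq> Y}"

lemma polys_in_mult:
  assumes "p \<in> polys_in Y" "q \<in> polys_in Y"
  shows "p * q \<in> polys_in Y"
proof -
  have "Poly_Mapping.keys m \<subseteq> Y" if m: "m \<in> Poly_Mapping.keys (p * q)" for m
  proof -
    obtain a b where ab: "m = a + b" "a \<in> Poly_Mapping.keys p" "b \<in> Poly_Mapping.keys q"
      using m keys_mult[of p q] by blast
    then have "Poly_Mapping.keys a \<subseteq> Y" "Poly_Mapping.keys b \<subseteq> Y"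
      using assms by (auto simp: polys_in_def)
    then show ?thesis
      using Poly_Mapping.keys_add[of a b] ab(1) by blast
  qed
  then show ?thesis by (simp add: polys_in_def)
qed

lemma polys_in_single: "Poly_Mapping.keys m \<subseteq> Y \<Longrightarrow> Poly_Mapping.single m c \<in> polys_in Y"
  by (auto simp: polys_in_def split: if_splits)

lemma specialize_in_polys_in: "specialize Y p \<in> polys_in Y"
proof -
  have "Poly_Mapping.keys m \<subseteq> Y" if "m \<in> Poly_Mapping.keys (specialize Y p)" for m
    using that subsetD[OF keys_sum that[unfolded specialize_def]] keys_restrict_exponent
    by (auto split: if_splits)
  then show ?thesis by (simp add: polys_in_def)
qed

text \<open>Summing over \<open>Y\<close> instead of over the support makes the weight additive; on monomials in the
  variables of \<open>Y\<close> it is the total degree.\<close>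
definition weight :: "nat set \<Rightarrow> (nat \<Rightarrow>\<^sub>0 nat) \<Rightarrow> nat" where
  "weight Y m = (\<Sum>i\<in>Y. Poly_Mapping.lookup m i)"

text \<open>For polynomials in the variables of \<open>Y\<close> this is membership in the \<open>k\<close>-th power of the ideal
  generated by these variables.\<close>
definition order_at_least :: "nat set \<Rightarrow> nat \<Rightarrow> 'k::comm_ring_1 mpoly \<Rightarrow> bool" where
  "order_at_least Y k p \<longleftrightarrow> (\<forall>m \<in> Poly_Mapping.keys p. k \<le> weight Y m)"

lemma order_at_least_mult:
  assumes "order_at_least Y j p" "order_at_least Y k q"
  shows "order_at_least Y (j + k) (p * q)"
  unfolding order_at_least_def
proof
  fix m assume "m \<in> Poly_Mapping.keys (p * q)"
  then obtain a b where ab: "m = a + b" "a \<in> Poly_Mapping.keys p" "b \<in> Poly_Mapping.keys q"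
    using keys_mult[of p q] by blast
  then have "j \<le> weight Y a" "k \<le> weight Y b"
    using assms by (auto simp: order_at_least_def)
  then show "j + k \<le> weight Y m"
    by (simp add: ab(1) weight_def lookup_add sum.distrib)
qed

lemma order_at_least_power: "order_at_least Y 1 p \<Longrightarrow> order_at_least Y k (p ^ k)"
proof (induction k)
  case (Suc k)
  then show ?case using order_at_least_mult[of Y 1 p k "p ^ k"] by simp
qed (simp add: order_at_least_def)

lemma order_at_least_prod_power:
  assumes "\<And>i. i \<in> S \<Longrightarrow> order_at_least Y 1 (F i)"
  shows "order_at_least Y (\<Sum>i\<in>S. a i) (\<Prod>i\<in>S. F i ^ a i)"
  using assms
proof (induction S rule: infinite_finite_induct)
  case (insert i S)
  then have "order_at_least Y (a i) (F i ^ a i)"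
    by (intro order_at_least_power) blast
  then show ?case
    using insert by (simp add: order_at_least_mult)
qed (auto simp: order_at_least_def)

lemma order_at_least_one:
  assumes "finite Y" "p \<in> polys_in Y" "Poly_Mapping.lookup p 0 = 0"
  shows "order_at_least Y 1 p"
  unfolding order_at_least_def
proof
  fix m assume m: "m \<in> Poly_Mapping.keys p"
  then have "m \<noteq> 0" "Poly_Mapping.keys m \<subseteq> Y"
    using assms by (auto simp: polys_in_def in_keys_iff)
  then obtain i where "i \<in> Y" "Poly_Mapping.lookup m i \<noteq> 0"
    by (metis in_keys_iff keys_eq_empty all_not_in_conv subsetD)
  then show "1 \<le> weight Y m"
    using member_le_sum[of i Y "Poly_Mapping.lookup m"] assms(1) by (simp add: weight_def)
qed

text \<open>Truncation represents the residue class modulo the \<open>k\<close>-th power of the ideal generated by the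
  variables of \<open>Y\<close> by its canonical representative, so that dimensions can be counted inside the polynomials
  themselves.\<close>
definition truncate_below :: "nat set \<Rightarrow> nat \<Rightarrow> 'k::comm_ring_1 mpoly \<Rightarrow> 'k mpoly" where
  "truncate_below Y k p = Poly_Mapping.mapp (\<lambda>m c. if weight Y m < k then c else 0) p"

lemma lookup_truncate_below: "Poly_Mapping.lookup (truncate_below Y k p) m = (if weight Y m < k then Poly_Mapping.lookup p m else 0)"
  by (simp add: truncate_below_def lookup_mapp when_def in_keys_iff)

lemma lookup_scale: "Poly_Mapping.lookup (Poly_Mapping.single 0 c * p) m = c * Poly_Mapping.lookup p m"
  for p :: "'k::comm_ring_1 mpoly"
  by (simp add: mult_map_scale_conv_mult[symmetric] map.rep_eq when_def)

lemma truncate_below_sum: "truncate_below Y k (sum f A) = (\<Sum>x\<in>A. truncate_below Y k (f x))"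
  by (rule poly_mapping_eqI) (simp add: lookup_truncate_below lookup_sum)

lemma truncate_below_scale:
  "truncate_below Y k (Poly_Mapping.single 0 c * p) = Poly_Mapping.single 0 c * truncate_below Y k p"
  by (rule poly_mapping_eqI) (simp add: lookup_truncate_below lookup_scale)

lemma truncate_below_eq_zero: "order_at_least Y k p \<Longrightarrow> truncate_below Y k p = 0"
  by (rule poly_mapping_eqI) (auto simp: lookup_truncate_below order_at_least_def in_keys_iff not_le[symmetric])

lemma truncate_below_single: "weight Y m < k \<Longrightarrow> truncate_below Y k (Poly_Mapping.single m c) = Poly_Mapping.single m c"
  by (rule poly_mapping_eqI) (auto simp: lookup_truncate_below lookup_single when_def)

interpretation mpoly_space: vector_space "\<lambda>(c::'k::field) (p::'k mpoly). Poly_Mapping.single 0 c * p"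
  by unfold_locales (simp_all add: distrib_left distrib_right single_add mult_single mult.assoc[symmetric])

lemma monomials_independent:
  "\<not> mpoly_space.dependent ((\<lambda>m. Poly_Mapping.single m (1::'k::field)) ` A)"
  unfolding mpoly_space.independent_explicit_finite_subsets
proof (intro allI impI ballI)
  fix T u v
  assume T: "T \<subseteq> (\<lambda>m. Poly_Mapping.single m (1::'k)) ` A" and fin: "finite T"
    and zero: "(\<Sum>v\<in>T. Poly_Mapping.single 0 (u v) * v) = 0" and v: "v \<in> T"
  obtain m where m: "v = Poly_Mapping.single m 1" using T v by blast
  have "0 = Poly_Mapping.lookup (\<Sum>w\<in>T. Poly_Mapping.single 0 (u w) * w) m"
    by (simp add: zero)
  also have "\<dots> = (\<Sum>w\<in>T. if w = v then u w else 0)"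
  proof -
    have "Poly_Mapping.lookup w m = (if w = v then 1 else 0)" if "w \<in> T" for w
      using T m that by (auto simp: lookup_single when_def)
    then show ?thesis
      by (auto simp: lookup_sum lookup_scale intro!: sum.cong)
  qed
  also have "\<dots> = u v"
    using fin v by simp
  finally show "u v = 0" ..
qed

text \<open>The box with bound \<open>N\<close> serves as a finite set of monomials outside which some \<open>N\<close>-th power of a
  variable can be split off. The box with bound \<open>q\<close> supplies many independent monomials.\<close>
definition box :: "nat set \<Rightarrow> nat \<Rightarrow> (nat \<Rightarrow>\<^sub>0 nat) set" where
  "box Y N = {m. Poly_Mapping.keys m \<subseteq> Y \<and> (\<forall>i\<in>Y. Poly_Mapping.lookup m i < N)}"

lemma
  assumes "finite Y"
  shows card_box: "card (box Y N) = N ^ card Y" and finite_box: "finite (box Y N)"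
proof -
  have bij: "bij_betw (\<lambda>m. restrict (Poly_Mapping.lookup m) Y) (box Y N) (Y \<rightarrow>\<^sub>E {..<N})"
  proof (rule bij_betw_imageI)
    show "inj_on (\<lambda>m. restrict (Poly_Mapping.lookup m) Y) (box Y N)"
    proof (rule inj_onI, rule poly_mapping_eqI)
      fix m m' i
      assume "m \<in> box Y N" "m' \<in> box Y N" and eq: "restrict (Poly_Mapping.lookup m) Y = restrict (Poly_Mapping.lookup m') Y"
      then have "Poly_Mapping.lookup m i = 0 \<and> Poly_Mapping.lookup m' i = 0" if "i \<notin> Y"
        using that by (auto simp: box_def in_keys_iff)
      moreover have "Poly_Mapping.lookup m i = Poly_Mapping.lookup m' i" if "i \<in> Y"
        using fun_cong[OF eq, of i] that by simp
      ultimately show "Poly_Mapping.lookup m i = Poly_Mapping.lookup m' i" by fastforce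
    qed
    show "(\<lambda>m. restrict (Poly_Mapping.lookup m) Y) ` box Y N = (Y \<rightarrow>\<^sub>E {..<N})"
    proof (intro equalityI subsetI)
      fix h assume h: "h \<in> Y \<rightarrow>\<^sub>E {..<N}"
      define m where "m = Poly_Mapping.Abs_poly_mapping (\<lambda>i. if i \<in> Y then h i else 0)"
      have lm: "Poly_Mapping.lookup m i = (if i \<in> Y then h i else 0)" for i
        unfolding m_def using assms by (subst lookup_Abs_poly_mapping) (auto elim: rev_finite_subset)
      have "m \<in> box Y N"
        using h by (auto simp: box_def in_keys_iff lm split: if_splits)
      moreover have "restrict (Poly_Mapping.lookup m) Y = h"
        using h by (auto simp: lm PiE_def extensional_def fun_eq_iff)
      ultimately show "h \<in> (\<lambda>m. restrict (Poly_Mapping.lookup m) Y) ` box Y N" by blast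
    qed (auto simp: box_def)
  qed
  show "card (box Y N) = N ^ card Y"
    using bij_betw_same_card[OF bij] assms by (simp add: card_PiE)
  show "finite (box Y N)"
    using bij_betw_finite[OF bij] assms by (simp add: finite_PiE)
qed

text \<open>A monomial outside the box has a factor \<open>y\<^sup>N\<close>, which can be replaced by a combination of the
  \<open>F i\<close>; this moves one more factor \<open>F i\<close> into the product in front. Each such move raises the
  order of that product by at least one, and once the order reaches \<open>k\<close> the truncation is zero. So
  the process stops with box monomials multiplied by products of fewer than \<open>k\<close> factors \<open>F i\<close>. The
  number \<open>j\<close> bounds the moves that are still possible.\<close>
lemma truncated_products_span:
  fixes F :: "'s \<Rightarrow> 'k::field mpoly" and c :: "nat \<Rightarrow> 's \<Rightarrow> 'k mpoly"
  assumes Y: "finite Y" and S: "finite S"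
    and F: "\<And>i. i \<in> S \<Longrightarrow> order_at_least Y 1 (F i)"
    and c: "\<And>y i. y \<in> Y \<Longrightarrow> i \<in> S \<Longrightarrow> c y i \<in> polys_in Y"
    and N: "\<And>y. y \<in> Y \<Longrightarrow> var y ^ N = (\<Sum>i\<in>S. c y i * F i)"
    and p: "p \<in> polys_in Y" "k \<le> (\<Sum>i\<in>S. a i) + j"
  shows "truncate_below Y k ((\<Prod>i\<in>S. F i ^ a i) * p) \<in>
     mpoly_space.span ((\<lambda>(a, m). truncate_below Y k ((\<Prod>i\<in>S. F i ^ a i) * Poly_Mapping.single m 1))
       ` ((S \<rightarrow>\<^sub>E {..k}) \<times> box Y N))" (is "_ \<in> mpoly_space.span ?G")
  using p
proof (induction j arbitrary: a p)
  case 0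
  have "order_at_least Y ((\<Sum>i\<in>S. a i) + 0) ((\<Prod>i\<in>S. F i ^ a i) * p)"
    by (intro order_at_least_mult order_at_least_prod_power F) (auto simp: order_at_least_def)
  then have "order_at_least Y k ((\<Prod>i\<in>S. F i ^ a i) * p)"
    using 0(2) by (auto simp: order_at_least_def intro: le_trans)
  then show ?case
    by (simp add: truncate_below_eq_zero mpoly_space.span_zero)
next
  case (Suc j)
  let ?g = "\<Prod>i\<in>S. F i ^ a i"
  show ?case
  proof (cases "k \<le> (\<Sum>i\<in>S. a i) + j")
    case True
    then show ?thesis using Suc.IH Suc.prems(1) by blast
  next
    case False
    have monomial: "truncate_below Y k (?g * Poly_Mapping.single m 1) \<in> mpoly_space.span ?G"
      if m: "Poly_Mapping.keys m \<subseteq> Y" for m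
    proof (cases "m \<in> box Y N")
      case True
      have "a i \<le> k" if "i \<in> S" for i
        using member_le_sum[of i S a] that S False by auto
      then have "(restrict a S, m) \<in> (S \<rightarrow>\<^sub>E {..k}) \<times> box Y N"
        using True by auto
      moreover have "(\<Prod>i\<in>S. F i ^ restrict a S i) = ?g"
        by (intro prod.cong) auto
      ultimately have "truncate_below Y k (?g * Poly_Mapping.single m 1) \<in> ?G"
        by (intro image_eqI[of _ _ "(restrict a S, m)"]) (simp_all only: prod.case)
      then show ?thesis by (rule mpoly_space.span_base)
    next
      case False
      then obtain y where y: "y \<in> Y" "N \<le> Poly_Mapping.lookup m y"
        using m by (auto simp: box_def not_less)
      define m' where "m' = m - Poly_Mapping.single y N"
      have mm': "m = m' + Poly_Mapping.single y N"
        using y(2) by (intro poly_mapping_eqI) (auto simp: m'_def lookup_add lookup_minus lookup_single when_def)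
      have m'Y: "Poly_Mapping.keys m' \<subseteq> Y"
        using m by (auto simp: m'_def in_keys_iff lookup_minus)
      have pow: "var y ^ e = (Poly_Mapping.single (Poly_Mapping.single y e) 1 :: 'k mpoly)" for e
        by (induction e) (simp_all add: var_def mult_single single_add[symmetric])
      have "?g * Poly_Mapping.single m 1 = ?g * (Poly_Mapping.single m' 1 * var y ^ N)"
        by (simp add: pow mult_single mm'[symmetric])
      also have "\<dots> = (\<Sum>i\<in>S. (F i * ?g) * (Poly_Mapping.single m' 1 * c y i))"
        unfolding N[OF y(1)] by (simp add: sum_distrib_left mult_ac)
      also have "\<dots> = (\<Sum>i\<in>S. (\<Prod>l\<in>S. F l ^ (a(i := Suc (a i))) l) * (Poly_Mapping.single m' 1 * c y i))"
      proof (intro sum.cong refl)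
        fix i assume i: "i \<in> S"
        have "(\<Prod>l\<in>S. F l ^ (a(i := Suc (a i))) l) = F i * ?g"
          by (simp add: prod.remove[OF S i] mult.assoc)
        then show "(F i * ?g) * (Poly_Mapping.single m' 1 * c y i)
            = (\<Prod>l\<in>S. F l ^ (a(i := Suc (a i))) l) * (Poly_Mapping.single m' 1 * c y i)" by simp
      qed
      finally have eq: "truncate_below Y k (?g * Poly_Mapping.single m 1) = (\<Sum>i\<in>S.
          truncate_below Y k ((\<Prod>l\<in>S. F l ^ (a(i := Suc (a i))) l) * (Poly_Mapping.single m' 1 * c y i)))"
        by (simp only: truncate_below_sum)
      show ?thesis
        unfolding eq
      proof (intro mpoly_space.span_sum Suc.IH)
        fix i assume i: "i \<in> S"
        show "Poly_Mapping.single m' 1 * c y i \<in> polys_in Y"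
          using polys_in_mult[OF polys_in_single[OF m'Y] c[OF y(1) i]] .
        have "(\<Sum>l\<in>S. (a(i := Suc (a i))) l) = Suc (\<Sum>l\<in>S. a l)"
          by (simp add: sum.remove[OF S i])
        then show "k \<le> (\<Sum>l\<in>S. (a(i := Suc (a i))) l) + j"
          using Suc.prems(2) by simp
      qed
    qed
    have "?g * p = (\<Sum>m\<in>Poly_Mapping.keys p. Poly_Mapping.single 0 (Poly_Mapping.lookup p m) * (?g * Poly_Mapping.single m 1))"
      by (subst poly_mapping_sum_singles[of p])
        (simp add: sum_distrib_left mult.left_commute[of "Poly_Mapping.single 0 _"] mult_single)
    then have "truncate_below Y k (?g * p) = (\<Sum>m\<in>Poly_Mapping.keys p.
        Poly_Mapping.single 0 (Poly_Mapping.lookup p m) * truncate_below Y k (?g * Poly_Mapping.single m 1))"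
      by (simp only: truncate_below_sum truncate_below_scale)
    then show ?thesis
      using Suc.prems(1)
      by (auto simp: polys_in_def intro!: mpoly_space.span_sum mpoly_space.span_scale monomial)
  qed
qed

text \<open>The left side grows like \<open>q\<close> to the power \<open>m\<close>, the right side like \<open>q\<close> to the power \<open>s\<close>.\<close>
lemma power_growth_bound:
  fixes m s :: nat
  assumes "\<And>q. q \<ge> 1 \<Longrightarrow> q ^ m \<le> (m * q + 2) ^ s * D"
  shows "m \<le> s"
proof (rule ccontr)
  assume "\<not> m \<le> s"
  then have sm: "Suc s \<le> m" by simp
  define q where "q = (m + 2) ^ s * D + 1"
  have q1: "q \<ge> 1" by (simp add: q_def)
  have "q ^ s * q \<le> q ^ m"
    using power_increasing[OF sm q1] by (simp add: mult.commute)
  also have "\<dots> \<le> (m * q + 2) ^ s * D"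
    by (rule assms[OF q1])
  also have "\<dots> \<le> ((m + 2) * q) ^ s * D"
    using q1 by (intro mult_right_mono power_mono) (simp_all add: algebra_simps)
  also have "\<dots> = q ^ s * ((m + 2) ^ s * D)"
    by (simp only: power_mult_distrib mult_ac)
  finally have "q \<le> (m + 2) ^ s * D"
    using q1 by (subst (asm) mult_le_cancel1) auto
  then show False by (simp add: q_def)
qed

text \<open>If every variable in \<open>Y\<close> has a power in the ideal generated by the \<open>F i\<close>, and the \<open>F i\<close> vanish at
  the origin, then there are at least as many \<open>F i\<close> as variables. This is the case of Krull's
  height theorem for the ideal of the origin. Here it follows from a dimension count: modulo
  polynomials of order \<open>k\<close>, products of powers of the \<open>F i\<close> with finitely many fixed monomials span
  everything, and there are at most a constant times \<open>(k + 1) ^ card S\<close> of them, whereas the number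
  of monomials of degree less than \<open>k\<close> grows like \<open>k ^ card Y\<close>.\<close>
lemma card_variables_le:
  fixes F :: "'s \<Rightarrow> 'k::field mpoly"
  assumes Y: "finite Y" and S: "finite S"
    and F: "\<And>i. i \<in> S \<Longrightarrow> F i \<in> polys_in Y" "\<And>i. i \<in> S \<Longrightarrow> Poly_Mapping.lookup (F i) 0 = 0"
    and var: "\<And>y. y \<in> Y \<Longrightarrow> \<exists>N c. (\<forall>i\<in>S. c i \<in> polys_in Y) \<and> var y ^ N = (\<Sum>i\<in>S. c i * F i)"
  shows "card Y \<le> card S"
proof -
  obtain N c where c: "\<And>y i. y \<in> Y \<Longrightarrow> i \<in> S \<Longrightarrow> c y i \<in> polys_in Y"
    and N: "\<And>y. y \<in> Y \<Longrightarrow> var y ^ N y = (\<Sum>i\<in>S. c y i * F i)"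
    using var by metis
  \<comment> \<open>An exponent that serves all variables at once.\<close>
  define M where "M = (\<Sum>y\<in>Y. N y)"
  define d where "d y i = var y ^ (M - N y) * c y i" for y i
  have varY: "var y ^ e \<in> (polys_in Y :: 'k mpoly set)" if "y \<in> Y" for y e
  proof (induction e)
    case 0
    show ?case by (simp add: polys_in_def)
  next
    case (Suc e)
    have "(var y :: 'k mpoly) \<in> polys_in Y"
      using that unfolding var_def by (intro polys_in_single) simp
    then show ?case using polys_in_mult Suc by simp
  qed
  have d: "d y i \<in> polys_in Y" if "y \<in> Y" "i \<in> S" for y i
    unfolding d_def using polys_in_mult[OF varY c] that by blast
  have M: "var y ^ M = (\<Sum>i\<in>S. d y i * F i)" if "y \<in> Y" for y
  proof -
    have "N y \<le> M" unfolding M_def using member_le_sum[OF that, of N] Y by simp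
    then have "var y ^ M = var y ^ (M - N y) * (var y ^ N y :: 'k mpoly)"
      by (simp add: power_add[symmetric])
    then show ?thesis
      by (simp add: N[OF that] d_def sum_distrib_left mult.assoc)
  qed
  have Ford: "order_at_least Y 1 (F i)" if "i \<in> S" for i
    using order_at_least_one[OF Y] F that by blast
  show ?thesis
  proof (rule power_growth_bound)
    fix q :: nat
    \<comment> \<open>All monomials of the box with bound \<open>q\<close> have weight below this \<open>k\<close>, so truncation keeps them.\<close>
    define k where "k = card Y * q + 1"
    let ?D = "(S \<rightarrow>\<^sub>E {..k}) \<times> box Y M"
    let ?G = "(\<lambda>(a, m). truncate_below Y k ((\<Prod>i\<in>S. F i ^ a i) * Poly_Mapping.single m 1)) ` ?D"
    let ?B = "(\<lambda>m. Poly_Mapping.single m (1::'k)) ` box Y q"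
    have finD: "finite ?D"
      using S finite_box[OF Y] by (simp add: finite_PiE)
    have "?B \<subseteq> mpoly_space.span ?G"
    proof
      fix p assume "p \<in> ?B"
      then obtain m where m: "m \<in> box Y q" "p = Poly_Mapping.single m 1" by blast
      have "weight Y m \<le> card Y * q"
        unfolding weight_def using m(1) sum_bounded_above[of Y "Poly_Mapping.lookup m" q]
        by (auto simp: box_def less_imp_le)
      then have "truncate_below Y k ((\<Prod>i\<in>S. F i ^ (\<lambda>_. 0) i) * p) = p"
        by (simp add: m(2) truncate_below_single k_def)
      moreover have "truncate_below Y k ((\<Prod>i\<in>S. F i ^ (\<lambda>_. 0) i) * p) \<in> mpoly_space.span ?G"
        using m by (intro truncated_products_span[OF Y S Ford d M, where j = k])
          (auto simp: box_def intro!: polys_in_single)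
      ultimately show "p \<in> mpoly_space.span ?G" by simp
    qed
    then have "card ?B \<le> card ?G"
      using mpoly_space.independent_span_bound[OF _ monomials_independent] finD by blast
    also have "\<dots> \<le> card ?D"
      by (rule card_image_le[OF finD])
    also have "\<dots> = (card Y * q + 2) ^ card S * M ^ card Y"
      using S Y by (simp add: card_cartesian_product card_PiE card_box k_def)
    finally have "card ?B \<le> (card Y * q + 2) ^ card S * M ^ card Y" .
    moreover have "inj_on (\<lambda>m. Poly_Mapping.single m (1::'k)) (box Y q)"
      by (rule inj_onI, drule arg_cong[of _ _ Poly_Mapping.keys]) simp
    ultimately show "q ^ card Y \<le> (card Y * q + 2) ^ card S * M ^ card Y"
      using card_box[OF Y, of q] by (simp only: card_image)
  qed
qed

section \<open>Two elements for a string of monomials\<close>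

text \<open>Ideals of a subring \<open>C\<close> of a ring given by a type class. Computations then use the operations of
  the type, with the simplifier setup available for them, and not those of a ring record.\<close>
definition subring_ideal :: "'a::comm_ring_1 set \<Rightarrow> 'a set \<Rightarrow> bool" where
  "subring_ideal C J \<longleftrightarrow> J \<subseteq> C \<and> 0 \<in> J \<and> (\<forall>x\<in>J. \<forall>y\<in>J. x + y \<in> J) \<and> (\<forall>c\<in>C. \<forall>x\<in>J. c * x \<in> J)"

text \<open>In the sequence of these elements for \<open>i = 0, \<dots>, s\<close>, each arises from its predecessor by
  exchanging \<open>a i\<close> for \<open>b i\<close>. They are, up to sign, the maximal minors of a matrix with \<open>s\<close> rows
  having entries \<open>a i\<close> and \<open>b i\<close> on two neighbouring diagonals. A run of consecutive path monomials
  has this form, after division by the variables common to all of them.\<close>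
definition string_monomial :: "(nat \<Rightarrow> 'a) \<Rightarrow> (nat \<Rightarrow> 'a) \<Rightarrow> nat \<Rightarrow> nat \<Rightarrow> 'a::comm_ring_1" where
  "string_monomial a b s i = (\<Prod>j\<in>{i..<s}. a j) * (\<Prod>j<i. b j)"

lemma string_monomial_Suc:
  "i \<le> s \<Longrightarrow> string_monomial a b (Suc s) i = a s * string_monomial a b s i"
  "string_monomial a b (Suc s) (Suc s) = b s * string_monomial a b s s"
  by (simp_all add: string_monomial_def mult.commute mult.left_commute)

locale concrete_subring =
  fixes C :: "'a::comm_ring_1 set"
  assumes one_closed: "1 \<in> C"
    and add_closed: "x \<in> C \<Longrightarrow> y \<in> C \<Longrightarrow> x + y \<in> C"
    and mult_closed: "x \<in> C \<Longrightarrow> y \<in> C \<Longrightarrow> x * y \<in> C"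
    and uminus_closed: "x \<in> C \<Longrightarrow> - x \<in> C"
begin

lemma zero_closed: "0 \<in> C"
  using add_closed[OF one_closed uminus_closed[OF one_closed]] by simp

lemma diff_closed: "x \<in> C \<Longrightarrow> y \<in> C \<Longrightarrow> x - y \<in> C"
  using add_closed[OF _ uminus_closed, of x y] by simp

lemma power_closed: "x \<in> C \<Longrightarrow> x ^ k \<in> C"
  by (induction k) (simp_all add: one_closed mult_closed)

lemma sum_closed: "(\<And>x. x \<in> A \<Longrightarrow> f x \<in> C) \<Longrightarrow> sum f A \<in> C"
  by (induction A rule: infinite_finite_induct) (simp_all add: zero_closed add_closed)

lemma prod_closed: "(\<And>x. x \<in> A \<Longrightarrow> f x \<in> C) \<Longrightarrow> prod f A \<in> C"
  by (induction A rule: infinite_finite_induct) (simp_all add: one_closed mult_closed)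

lemmas closed = zero_closed one_closed add_closed mult_closed uminus_closed diff_closed
  power_closed sum_closed prod_closed

lemma string_monomial_closed:
  "(\<And>j. j < s \<Longrightarrow> a j \<in> C) \<Longrightarrow> (\<And>j. j < s \<Longrightarrow> b j \<in> C) \<Longrightarrow> i \<le> s \<Longrightarrow> string_monomial a b s i \<in> C"
  unfolding string_monomial_def by (intro closed) auto

text \<open>Turns an assumption about multiples of given elements into one about the elements themselves.\<close>
lemma colon_ideal:
  assumes "subring_ideal C J" "c \<in> C"
  shows "subring_ideal C {x \<in> C. c * x \<in> J}"
  using assms by (auto simp: subring_ideal_def closed distrib_left mult.left_commute)

lemma subring_ideal_diff:
  assumes "subring_ideal C J" "x \<in> J" "y \<in> J"
  shows "x - y \<in> J"
proof -
  have "(- 1) * y \<in> J"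
    using assms unfolding subring_ideal_def by (blast intro: closed)
  then have "x + (- 1) * y \<in> J"
    using assms unfolding subring_ideal_def by blast
  then show ?thesis by simp
qed

text \<open>Passing from \<open>s\<close> to \<open>s + 1\<close> multiplies all elements of the string by \<open>a\<close> and appends \<open>b p\<close>, where
  \<open>p\<close> is the previous last element. Suppose that the old string has the radical of \<open>(f, g)\<close>; after
  replacing \<open>p\<close> and \<open>b\<close> by powers, \<open>p = \<alpha> f + \<beta> g\<close>. Then
  \<open>F = a f - b p \<beta>\<close> and \<open>G = a g + b p \<alpha>\<close> serve for the new string. They clearly lie in the ideal
  \<open>(a f, a g, b p)\<close>. Conversely \<open>\<alpha> F + \<beta> G = a p\<close>, hence \<open>a\<^sup>2 f = a F + b \<beta> (a p)\<close> and
  \<open>a\<^sup>2 g = a G - b \<alpha> (a p)\<close> lie in \<open>(F, G)\<close>, and so does \<open>b p\<^sup>2 = f G - g F\<close>.\<close>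
lemma string_two_elements:
  assumes "\<And>j. j < s \<Longrightarrow> a j \<in> C" "\<And>j. j < s \<Longrightarrow> b j \<in> C"
  shows "\<exists>f\<in>C. \<exists>g\<in>C.
     (\<forall>J. subring_ideal C J \<longrightarrow> (\<forall>i\<le>s. string_monomial a b s i \<in> J) \<longrightarrow> f \<in> J \<and> g \<in> J) \<and>
     (\<forall>i\<le>s. \<exists>N. \<exists>\<alpha>\<in>C. \<exists>\<beta>\<in>C. string_monomial a b s i ^ N = \<alpha> * f + \<beta> * g)"
  using assms
proof (induction s)
  case 0
  have "string_monomial a b 0 0 ^ 0 = 1 * 1 + 0 * 0"
    by simp
  then have "\<exists>N. \<exists>\<alpha>\<in>C. \<exists>\<beta>\<in>C. string_monomial a b 0 i ^ N = \<alpha> * 1 + \<beta> * 0" if "i \<le> 0" for i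
    using that closed(1,2) by blast
  then show ?case
    by (intro bexI[of _ 1] bexI[of _ 0])
      (auto simp: subring_ideal_def string_monomial_def closed(1,2))
next
  case (Suc s)
  have as: "a s \<in> C" and bs: "b s \<in> C" using Suc.prems by auto
  let ?p = "string_monomial a b s s"
  have pC: "string_monomial a b s i \<in> C" if "i \<le> s" for i
    using that Suc.prems by (intro string_monomial_closed) auto
  obtain f g where fg: "f \<in> C" "g \<in> C"
    and sub: "\<And>J. subring_ideal C J \<Longrightarrow> (\<forall>i\<le>s. string_monomial a b s i \<in> J) \<Longrightarrow> f \<in> J \<and> g \<in> J"
    and rad: "\<And>i. i \<le> s \<Longrightarrow> \<exists>N. \<exists>\<alpha>\<in>C. \<exists>\<beta>\<in>C. string_monomial a b s i ^ N = \<alpha> * f + \<beta> * g"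
    using Suc by (metis less_Suc_eq)
  obtain N \<alpha>0 \<beta>0 where N: "\<alpha>0 \<in> C" "\<beta>0 \<in> C" "?p ^ N = \<alpha>0 * f + \<beta>0 * g"
    using rad[of s] by blast
  \<comment> \<open>Passing to a positive exponent makes the power a multiple of the monomial itself.\<close>
  define \<alpha> where "\<alpha> = ?p * \<alpha>0"
  define \<beta> where "\<beta> = ?p * \<beta>0"
  define q where "q = ?p ^ Suc N"
  define B where "B = b s ^ Suc N"
  have q: "q = \<alpha> * f + \<beta> * g"
    using N(3) by (simp add: q_def \<alpha>_def \<beta>_def distrib_left mult.assoc)
  have \<alpha>\<beta>: "\<alpha> \<in> C" "\<beta> \<in> C" "q \<in> C" "B \<in> C"
    unfolding \<alpha>_def \<beta>_def q_def B_def by (intro closed N pC bs order_refl)+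
  define F where "F = a s * f - B * q * \<beta>"
  define G where "G = a s * g + B * q * \<alpha>"
  have FG: "F \<in> C" "G \<in> C"
    unfolding F_def G_def by (intro closed as fg \<alpha>\<beta>)+
  have e1: "a s ^ 2 * f = (a s + B * \<beta> * \<alpha>) * F + (B * \<beta> * \<beta>) * G"
    and e2: "a s ^ 2 * g = (- (B * \<alpha> * \<alpha>)) * F + (a s - B * \<alpha> * \<beta>) * G"
    and e3: "B ^ 2 * q ^ 2 = (- (B * g)) * F + (B * f) * G"
    unfolding F_def G_def q by (simp_all add: algebra_simps power2_eq_square)
  have Bq: "(b s * ?p) ^ Suc N = B * q"
    by (simp only: B_def q_def power_mult_distrib)
  show ?case
  proof (rule bexI[of _ F], rule bexI[of _ G], intro conjI allI impI)
    fix J assume J: "subring_ideal C J"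
      and mem: "\<forall>i\<le>Suc s. string_monomial a b (Suc s) i \<in> J"
    have "a s * f \<in> J \<and> a s * g \<in> J"
      using sub[OF colon_ideal[OF J as]] mem by (auto simp: pC simp flip: string_monomial_Suc)
    moreover have "B * q \<in> J"
    proof -
      have "b s * ?p \<in> J"
        using mem by (metis order_refl string_monomial_Suc(2))
      then have "(b s * ?p) ^ N * (b s * ?p) \<in> J"
        using J unfolding subring_ideal_def by (blast intro: closed as bs pC)
      then show ?thesis
        using Bq by (simp add: mult.commute)
    qed
    then have "\<beta> * (B * q) \<in> J" "\<alpha> * (B * q) \<in> J"
      using J \<alpha>\<beta> unfolding subring_ideal_def by blast+
    ultimately show "F \<in> J" "G \<in> J"
      using J subring_ideal_diff[OF J] unfolding subring_ideal_def F_def G_def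
      by (simp_all add: mult.commute)
  next
    fix i assume "i \<le> Suc s"
    show "\<exists>N. \<exists>\<alpha>\<in>C. \<exists>\<beta>\<in>C. string_monomial a b (Suc s) i ^ N = \<alpha> * F + \<beta> * G"
    proof (cases "i = Suc s")
      case True
      have "string_monomial a b (Suc s) i ^ (Suc N * 2) = (B * q) ^ 2"
        unfolding True string_monomial_Suc power_mult Bq ..
      also have "\<dots> = (- (B * g)) * F + (B * f) * G"
        unfolding e3[symmetric] by (rule power_mult_distrib)
      finally show ?thesis
        by (intro exI[of _ "Suc N * 2"] bexI) (assumption | intro closed \<alpha>\<beta> fg)+
    next
      case False
      then have i: "i \<le> s" using \<open>i \<le> Suc s\<close> by simp
      let ?m = "string_monomial a b s i"
      obtain M \<gamma> \<delta> where M: "\<gamma> \<in> C" "\<delta> \<in> C" "?m ^ M = \<gamma> * f + \<delta> * g"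
        using rad[OF i] by blast
      have "string_monomial a b (Suc s) i ^ (M + 2) = a s ^ M * ?m ^ 2 * (\<gamma> * (a s ^ 2 * f) + \<delta> * (a s ^ 2 * g))"
        unfolding string_monomial_Suc(1)[OF i] power_mult_distrib power_add M(3)
        by (simp add: algebra_simps)
      also have "\<dots> = (a s ^ M * ?m ^ 2 * (\<gamma> * (a s + B * \<beta> * \<alpha>) + \<delta> * (- (B * \<alpha> * \<alpha>)))) * F
          + (a s ^ M * ?m ^ 2 * (\<gamma> * (B * \<beta> * \<beta>) + \<delta> * (a s - B * \<alpha> * \<beta>))) * G"
        unfolding e1 e2 by (simp add: algebra_simps)
      finally show ?thesis
        by (intro exI[of _ "M + 2"] bexI) (assumption | intro closed as fg \<alpha>\<beta> M pC i)+
    qed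
  qed (fact FG)+
qed

text \<open>A common factor \<open>c\<close> of the whole string is carried along: if \<open>f\<close> and \<open>g\<close> serve for the string, \<open>c f\<close> and
  \<open>c g\<close> serve for the scaled one.\<close>
lemma scaled_string_two_elements:
  assumes "\<And>j. j < s \<Longrightarrow> a j \<in> C" "\<And>j. j < s \<Longrightarrow> b j \<in> C" "c \<in> C"
  shows "\<exists>f\<in>C. \<exists>g\<in>C.
     (\<forall>J. subring_ideal C J \<longrightarrow> (\<forall>i\<le>s. c * string_monomial a b s i \<in> J) \<longrightarrow> f \<in> J \<and> g \<in> J) \<and>
     (\<forall>i\<le>s. \<exists>N. \<exists>\<alpha>\<in>C. \<exists>\<beta>\<in>C. (c * string_monomial a b s i) ^ N = \<alpha> * f + \<beta> * g)"
proof -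
  have mC: "string_monomial a b s i \<in> C" if "i \<le> s" for i
    using that assms by (intro string_monomial_closed) auto
  have "\<exists>f\<in>C. \<exists>g\<in>C.
     (\<forall>J. subring_ideal C J \<longrightarrow> (\<forall>i\<le>s. string_monomial a b s i \<in> J) \<longrightarrow> f \<in> J \<and> g \<in> J) \<and>
     (\<forall>i\<le>s. \<exists>N. \<exists>\<alpha>\<in>C. \<exists>\<beta>\<in>C. string_monomial a b s i ^ N = \<alpha> * f + \<beta> * g)"
    using assms by (intro string_two_elements) auto
  then obtain f g where fg: "f \<in> C" "g \<in> C"
    and sub: "\<And>J. subring_ideal C J \<Longrightarrow> (\<forall>i\<le>s. string_monomial a b s i \<in> J) \<Longrightarrow> f \<in> J \<and> g \<in> J"
    and rad: "\<And>i. i \<le> s \<Longrightarrow> \<exists>N. \<exists>\<alpha>\<in>C. \<exists>\<beta>\<in>C. string_monomial a b s i ^ N = \<alpha> * f + \<beta> * g"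
    by blast
  show ?thesis
  proof (rule bexI[of _ "c * f"], rule bexI[of _ "c * g"], intro conjI allI impI)
    fix J assume J: "subring_ideal C J" and mem: "\<forall>i\<le>s. c * string_monomial a b s i \<in> J"
    show "c * f \<in> J" "c * g \<in> J"
      using sub[OF colon_ideal[OF J assms(3)]] mem mC by auto
  next
    fix i assume i: "i \<le> s"
    let ?m = "string_monomial a b s i"
    obtain N \<alpha> \<beta> where N: "\<alpha> \<in> C" "\<beta> \<in> C" "?m ^ N = \<alpha> * f + \<beta> * g"
      using rad[OF i] by blast
    have "(c * ?m) ^ (N + 1) = (c ^ N * ?m * \<alpha>) * (c * f) + (c ^ N * ?m * \<beta>) * (c * g)"
      by (simp add: power_mult_distrib N(3) algebra_simps)
    then show "\<exists>N. \<exists>\<alpha>\<in>C. \<exists>\<beta>\<in>C. (c * ?m) ^ N = \<alpha> * (c * f) + \<beta> * (c * g)"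
      by (intro exI[of _ "N + 1"] bexI) (assumption | intro closed assms(3) N mC i)+
  qed (intro closed fg assms(3))+
qed

end

section \<open>Ideals and radicals in the polynomial ring\<close>

context concrete_subring
begin

lemma subring_ideal_sum:
  assumes "subring_ideal C J" "\<And>x. x \<in> A \<Longrightarrow> f x \<in> J"
  shows "sum f A \<in> J"
  using assms(2)
  by (induction A rule: infinite_finite_induct) (use assms(1) in \<open>auto simp: subring_ideal_def\<close>)

text \<open>By the binomial theorem: if \<open>x\<^sup>a\<close> and \<open>y\<^sup>b\<close> lie in the ideal, every term of the expansion of
  \<open>(x + y)\<^bsup>a + b\<^esup>\<close> contains at least one of them.\<close>
lemma radical_subring_ideal:
  assumes J: "subring_ideal C J"
  shows "subring_ideal C {x \<in> C. \<exists>k. x ^ k \<in> J}"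
proof -
  have mult: "c * x \<in> J" if "c \<in> C" "x \<in> J" for c x
    using J that by (simp add: subring_ideal_def)
  have "\<exists>k. (x + y) ^ k \<in> J" if xy: "x \<in> C" "y \<in> C" "x ^ a \<in> J" "y ^ b \<in> J" for x y a b
  proof (intro exI)
    have "of_nat r \<in> C" for r
      by (induction r) (simp_all add: closed)
    moreover have "x ^ r * y ^ (a + b - r) \<in> J" for r
    proof (cases "a \<le> r")
      case True
      have "x ^ r = x ^ (r - a) * x ^ a"
        using True by (simp add: power_add[symmetric])
      then have "x ^ r * y ^ (a + b - r) = (x ^ (r - a) * y ^ (a + b - r)) * x ^ a"
        by (simp add: mult_ac)
      then show ?thesis
        using xy by (simp add: mult closed)
    next
      case False
      have "y ^ (a + b - r) = y ^ (a - r) * y ^ b"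
        using False by (simp add: power_add[symmetric])
      then have "x ^ r * y ^ (a + b - r) = (x ^ r * y ^ (a - r)) * y ^ b"
        by (simp add: mult_ac)
      then show ?thesis
        using xy by (simp add: mult closed)
    qed
    ultimately have "of_nat (a + b choose r) * x ^ r * y ^ (a + b - r) \<in> J" for r
      by (simp add: mult mult.assoc del: mult_of_nat_commute)
    then show "(x + y) ^ (a + b) \<in> J"
      unfolding binomial_ring by (intro subring_ideal_sum[OF J])
  qed
  moreover have "\<exists>k. (c * x) ^ k \<in> J" if "c \<in> C" "x ^ a \<in> J" for c x a
    using that by (intro exI[of _ a]) (simp add: power_mult_distrib mult closed)
  moreover have "\<exists>k. 0 ^ k \<in> J"
    using J by (intro exI[of _ 1]) (simp add: subring_ideal_def)
  ultimately show ?thesis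
    by (fastforce simp: subring_ideal_def closed)
qed

lemma linear_combinations_ideal:
  "subring_ideal C {x \<in> C. \<exists>c. x = (\<Sum>s\<in>S. c s * s)}"
  unfolding subring_ideal_def
proof (intro conjI ballI)
  show "0 \<in> {x \<in> C. \<exists>c. x = (\<Sum>s\<in>S. c s * s)}"
    by (auto simp: closed intro: exI[of _ "\<lambda>_. 0"])
next
  fix x y assume "x \<in> {x \<in> C. \<exists>c. x = (\<Sum>s\<in>S. c s * s)}" "y \<in> {x \<in> C. \<exists>c. x = (\<Sum>s\<in>S. c s * s)}"
  then obtain c d where "x \<in> C" "y \<in> C" "x = (\<Sum>s\<in>S. c s * s)" "y = (\<Sum>s\<in>S. d s * s)" by blast
  then have "x + y \<in> C" "x + y = (\<Sum>s\<in>S. (c s + d s) * s)"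
    by (simp_all add: closed distrib_right sum.distrib)
  then show "x + y \<in> {x \<in> C. \<exists>c. x = (\<Sum>s\<in>S. c s * s)}" by (intro CollectI conjI exI)
next
  fix r x assume r: "r \<in> C" and "x \<in> {x \<in> C. \<exists>c. x = (\<Sum>s\<in>S. c s * s)}"
  then obtain c where "x \<in> C" "x = (\<Sum>s\<in>S. c s * s)" by blast
  then have "r * x = (\<Sum>s\<in>S. (r * c s) * s)"
    by (simp add: sum_distrib_left mult.assoc)
  moreover have "r * x \<in> C" using r \<open>x \<in> C\<close> by (rule mult_closed)
  ultimately show "r * x \<in> {x \<in> C. \<exists>c. x = (\<Sum>s\<in>S. c s * s)}" by (intro CollectI conjI exI)
qed blast

end

lemma mpoly_ring_simps:
  "monoid.mult (mpoly_ring n) = (*)" "monoid.one (mpoly_ring n) = 1"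
  "ring.zero (mpoly_ring n) = 0" "ring.add (mpoly_ring n) = (+)"
  by (simp_all add: mpoly_ring_def)

lemma concrete_subring_mpoly_ring:
  "concrete_subring (carrier (mpoly_ring n) :: 'k::comm_ring_1 mpoly set)"
  by unfold_locales (simp_all add: mpoly_ring_closed, simp add: mpoly_ring_def)

lemma ideal_mpoly_ring_iff:
  fixes J :: "'k::comm_ring_1 mpoly set"
  shows "ideal J (mpoly_ring n) \<longleftrightarrow> subring_ideal (carrier (mpoly_ring n)) J"
proof
  assume "ideal J (mpoly_ring n)"
  then interpret ideal J "mpoly_ring n" .
  show "subring_ideal (carrier (mpoly_ring n)) J"
    using a_subset additive_subgroup.zero_closed[OF is_additive_subgroup]
      additive_subgroup.a_closed[OF is_additive_subgroup] I_l_closed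
    by (simp add: subring_ideal_def mpoly_ring_simps)
next
  assume J: "subring_ideal (carrier (mpoly_ring n)) J"
  interpret cring "mpoly_ring n :: 'k mpoly ring" by (rule cring_mpoly_ring)
  interpret C: concrete_subring "carrier (mpoly_ring n) :: 'k mpoly set"
    by (rule concrete_subring_mpoly_ring)
  have neg: "\<ominus>\<^bsub>mpoly_ring n\<^esub> x = - x" if "x \<in> carrier (mpoly_ring n)" for x :: "'k mpoly"
    using that by (intro minus_equality) (simp_all add: mpoly_ring_simps C.closed)
  have "- x \<in> J" if "x \<in> J" for x
    using C.subring_ideal_diff[OF J, of 0 x] J that by (simp add: subring_ideal_def)
  then have "subgroup J (add_monoid (mpoly_ring n))"
    using J neg by (intro subgroup.intro) (auto simp: subring_ideal_def mpoly_ring_simps a_inv_def)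
  moreover have "c * x \<in> J" "x * c \<in> J" if "x \<in> J" "c \<in> carrier (mpoly_ring n)" for c x
    using J that by (simp_all add: subring_ideal_def mult.commute[of x c])
  ultimately show "ideal J (mpoly_ring n)"
    by (intro idealI ring_axioms) (simp_all add: mpoly_ring_simps)
qed

lemma radical_mpoly_ring:
  "radical (mpoly_ring n) I = {x \<in> carrier (mpoly_ring n). \<exists>k. x ^ k \<in> I}"
proof -
  have "x [^]\<^bsub>mpoly_ring n\<^esub> k = x ^ k" for x :: "'a mpoly" and k :: nat
    by (induction k) (simp_all add: nat_pow_def mpoly_ring_simps mult.commute)
  then show ?thesis by (simp add: radical_def)
qed

lemma subset_radical:
  fixes I :: "'k::comm_ring_1 mpoly set"
  shows "I \<subseteq> carrier (mpoly_ring n) \<Longrightarrow> I \<subseteq> radical (mpoly_ring n) I"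
  by (auto simp: radical_mpoly_ring intro: exI[of _ 1])

lemma ideal_radical:
  fixes I :: "'k::comm_ring_1 mpoly set"
  assumes "ideal I (mpoly_ring n)"
  shows "ideal (radical (mpoly_ring n) I) (mpoly_ring n)"
  using assms unfolding ideal_mpoly_ring_iff radical_mpoly_ring
  by (rule concrete_subring.radical_subring_ideal[OF concrete_subring_mpoly_ring])

lemma radical_eqI:
  fixes S G :: "'k::comm_ring_1 mpoly set"
  assumes "S \<subseteq> Idl\<^bsub>mpoly_ring n\<^esub> G" "G \<subseteq> radical (mpoly_ring n) (Idl\<^bsub>mpoly_ring n\<^esub> S)"
    "S \<subseteq> carrier (mpoly_ring n)" "G \<subseteq> carrier (mpoly_ring n)"
  shows "radical (mpoly_ring n) (Idl\<^bsub>mpoly_ring n\<^esub> S) = radical (mpoly_ring n) (Idl\<^bsub>mpoly_ring n\<^esub> G)"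
proof -
  interpret cring "mpoly_ring n :: 'k mpoly ring" by (rule cring_mpoly_ring)
  have "Idl\<^bsub>mpoly_ring n\<^esub> S \<subseteq> Idl\<^bsub>mpoly_ring n\<^esub> G"
    using assms by (intro genideal_minimal genideal_ideal)
  moreover have "Idl\<^bsub>mpoly_ring n\<^esub> G \<subseteq> radical (mpoly_ring n) (Idl\<^bsub>mpoly_ring n\<^esub> S)"
    using assms by (intro genideal_minimal ideal_radical genideal_ideal)
  ultimately show ?thesis
    unfolding radical_mpoly_ring by (auto simp: subset_iff) (metis power_mult)
qed

lemma Idl_linear_combination:
  fixes S :: "'k::comm_ring_1 mpoly set"
  assumes "finite S" "S \<subseteq> carrier (mpoly_ring n)" "x \<in> Idl\<^bsub>mpoly_ring n\<^esub> S"
  obtains c where "x = (\<Sum>s\<in>S. c s * s)"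
proof -
  interpret cring "mpoly_ring n :: 'k mpoly ring" by (rule cring_mpoly_ring)
  let ?L = "{x \<in> carrier (mpoly_ring n). \<exists>c. x = (\<Sum>s\<in>S. c s * s)}"
  have "ideal ?L (mpoly_ring n)"
    unfolding ideal_mpoly_ring_iff
    by (rule concrete_subring.linear_combinations_ideal[OF concrete_subring_mpoly_ring])
  moreover have "S \<subseteq> ?L"
  proof
    fix x assume x: "x \<in> S"
    have "x = (\<Sum>s\<in>S. (if s = x then 1 else 0) * s)"
      using x assms(1) by (simp add: if_distrib[of "\<lambda>c. c * _"] cong: if_cong)
    then have "\<exists>c. x = (\<Sum>s\<in>S. c s * s)" by (rule exI[of "\<lambda>c. x = (\<Sum>s\<in>S. c s * s)"])
    then show "x \<in> ?L" using x assms(2) by blast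
  qed
  ultimately have "Idl\<^bsub>mpoly_ring n\<^esub> S \<subseteq> ?L"
    by (rule genideal_minimal)
  then show ?thesis using assms(3) that by blast
qed

text \<open>A ring homomorphism carries a system of generators up to radical to such a system of the image
  ideal. The hypotheses say that specialization turns the ideal generated by \<open>G\<close> into one that lies
  between the variables of \<open>Y\<close> and the ideal of polynomials without constant term, so the bound for
  the ideal of the origin applies.\<close>
lemma card_le_of_specialized_variables:
  fixes S G :: "'k::field mpoly set"
  assumes S: "finite S" "S \<subseteq> carrier (mpoly_ring n)" and G: "G \<subseteq> carrier (mpoly_ring n)"
    and rad: "radical (mpoly_ring n) (Idl\<^bsub>mpoly_ring n\<^esub> S) = radical (mpoly_ring n) (Idl\<^bsub>mpoly_ring n\<^esub> G)"
    and Y: "finite Y"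
    and vanish: "\<And>g. g \<in> G \<Longrightarrow> Poly_Mapping.lookup (specialize Y g) 0 = 0"
    and hit: "\<And>y. y \<in> Y \<Longrightarrow> \<exists>g\<in>G. specialize Y g = var y"
  shows "card Y \<le> card S"
proof (rule card_variables_le[OF Y S(1), where F = "specialize Y"])
  interpret cring "mpoly_ring n :: 'k mpoly ring" by (rule cring_mpoly_ring)
  show "specialize Y s \<in> polys_in Y" for s :: "'k mpoly"
    by (rule specialize_in_polys_in)
  let ?K = "{p \<in> carrier (mpoly_ring n). Poly_Mapping.lookup (specialize Y p) 0 = (0::'k)}"
  have "ideal ?K (mpoly_ring n)"
    unfolding ideal_mpoly_ring_iff
    by (auto simp: subring_ideal_def specialize_add specialize_mult lookup_add lookup_mult_zero
        concrete_subring.closed[OF concrete_subring_mpoly_ring])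
  then have IdlG: "Idl\<^bsub>mpoly_ring n\<^esub> G \<subseteq> ?K"
    using G vanish by (intro genideal_minimal) auto
  show "Poly_Mapping.lookup (specialize Y s) 0 = 0" if s: "s \<in> S" for s
  proof -
    have "s \<in> radical (mpoly_ring n) (Idl\<^bsub>mpoly_ring n\<^esub> G)"
      using s S(2) genideal_self[OF S(2)] subset_radical[of "Idl\<^bsub>mpoly_ring n\<^esub> S"] rad
        genideal_ideal[OF S(2)] by (metis (no_types) ideal_mpoly_ring_iff subring_ideal_def subsetD)
    then obtain k where "s ^ k \<in> Idl\<^bsub>mpoly_ring n\<^esub> G"
      by (auto simp: radical_mpoly_ring)
    then have "Poly_Mapping.lookup (specialize Y (s ^ k)) 0 = 0"
      using IdlG by blast
    then show ?thesis
      by (simp add: specialize_power lookup_power_zero)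
  qed
  show "\<exists>N c. (\<forall>s\<in>S. c s \<in> polys_in Y) \<and> var y ^ N = (\<Sum>s\<in>S. c s * specialize Y s)"
    if y: "y \<in> Y" for y
  proof -
    obtain g where g: "g \<in> G" "specialize Y g = var y" using hit[OF y] by blast
    have "g \<in> radical (mpoly_ring n) (Idl\<^bsub>mpoly_ring n\<^esub> S)"
      using g(1) genideal_self[OF G] subset_radical[of "Idl\<^bsub>mpoly_ring n\<^esub> G"] rad
        genideal_ideal[OF G] by (metis (no_types) ideal_mpoly_ring_iff subring_ideal_def subsetD)
    then obtain N where "g ^ N \<in> Idl\<^bsub>mpoly_ring n\<^esub> S"
      by (auto simp: radical_mpoly_ring)
    then obtain c where "g ^ N = (\<Sum>s\<in>S. c s * s)"
      by (rule Idl_linear_combination[OF S])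
    then have "specialize Y (g ^ N) = specialize Y (\<Sum>s\<in>S. c s * s)" by simp
    then have "var y ^ N = (\<Sum>s\<in>S. specialize Y (c s) * specialize Y s)"
      by (simp add: specialize_power g(2) specialize_sum specialize_mult)
    then show ?thesis
      by (intro exI[of _ N] exI[of _ "\<lambda>s. specialize Y (c s)"]) (simp add: specialize_in_polys_in)
  qed
qed

section \<open>Path ideals\<close>

definition path_monomial :: "nat \<Rightarrow> nat \<Rightarrow> 'k::comm_ring_1 mpoly" where
  "path_monomial t i = (\<Prod>j\<in>{i..<i + t}. var j)"

definition path_monomials :: "nat \<Rightarrow> nat \<Rightarrow> 'k::comm_ring_1 mpoly set" where
  "path_monomials t n = path_monomial t ` {i. 1 \<le> i \<and> i + t \<le> n + 1}"

lemma path_ideal_eq: "path_ideal t n = Idl\<^bsub>mpoly_ring n\<^esub> (path_monomials t n)"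
  unfolding path_ideal_def path_monomials_def path_monomial_def
  by (rule arg_cong[where f = "genideal _"]) blast

lemma path_monomials_carrier: "path_monomials t n \<subseteq> carrier (mpoly_ring n)"
  by (auto simp: path_monomials_def path_monomial_def prod_var_in_carrier)

text \<open>Among the path monomials starting at \<open>i, \<dots>, i + s\<close> with \<open>s \<le> t\<close>, the variables with indices from
  \<open>i + s\<close> to \<open>i + t - 1\<close> are common to all; a step to the right drops one variable from the left
  part and adds one on the right.\<close>
lemma path_monomial_eq_string:
  assumes "r \<le> s" "s \<le> t"
  shows "path_monomial t (i + r) =
    (\<Prod>j\<in>{i + s..<i + t}. var j) * string_monomial (\<lambda>j. var (j + i)) (\<lambda>j. var (j + (i + t))) s r"
proof -
  have "path_monomial t (i + r) =
      (\<Prod>j\<in>{r + i..<s + i}. var j) * (\<Prod>j\<in>{i + s..<i + t}. var j) * (\<Prod>j\<in>{0 + (i + t)..<r + (i + t)}. var j)"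
    using assms by (simp add: path_monomial_def prod.atLeastLessThan_concat add_ac)
  then show ?thesis
    unfolding prod.shift_bounds_nat_ivl
    by (simp add: string_monomial_def lessThan_atLeast0 mult_ac)
qed

text \<open>The two elements come from the string lemma; what remains is to read its two conclusions as
  containments between ideals of the polynomial ring.\<close>
lemma consecutive_two_elements:
  assumes i: "1 \<le> i" and s: "s \<le> t" "i + s + t \<le> n + 1"
  shows "\<exists>S :: 'k::comm_ring_1 mpoly set. S \<subseteq> Idl\<^bsub>mpoly_ring n\<^esub> (path_monomials t n) \<and>
    finite S \<and> card S \<le> 2 \<and>
    (\<forall>r\<le>s. path_monomial t (i + r) \<in> radical (mpoly_ring n) (Idl\<^bsub>mpoly_ring n\<^esub> S))"
proof -
  interpret cring "mpoly_ring n :: 'k mpoly ring" by (rule cring_mpoly_ring)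
  let ?C = "carrier (mpoly_ring n) :: 'k mpoly set"
  interpret C: concrete_subring ?C by (rule concrete_subring_mpoly_ring)
  let ?I = "Idl\<^bsub>mpoly_ring n\<^esub> (path_monomials t n) :: 'k mpoly set"
  let ?c = "\<Prod>j\<in>{i + s..<i + t}. var j :: 'k mpoly"
  let ?m = "string_monomial (\<lambda>j. var (j + i)) (\<lambda>j. var (j + (i + t))) s :: nat \<Rightarrow> 'k mpoly"
  have "\<exists>f\<in>?C. \<exists>g\<in>?C.
     (\<forall>J. subring_ideal ?C J \<longrightarrow> (\<forall>r\<le>s. ?c * ?m r \<in> J) \<longrightarrow> f \<in> J \<and> g \<in> J) \<and>
     (\<forall>r\<le>s. \<exists>N. \<exists>\<alpha>\<in>?C. \<exists>\<beta>\<in>?C. (?c * ?m r) ^ N = \<alpha> * f + \<beta> * g)"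
    using i s by (intro C.scaled_string_two_elements C.prod_closed var_in_carrier) auto
  then obtain f g where fg: "f \<in> ?C" "g \<in> ?C"
    and sub: "\<And>J. subring_ideal ?C J \<Longrightarrow> (\<forall>r\<le>s. path_monomial t (i + r) \<in> J) \<Longrightarrow> f \<in> J \<and> g \<in> J"
    and rad: "\<And>r. r \<le> s \<Longrightarrow> \<exists>N. \<exists>\<alpha>\<in>?C. \<exists>\<beta>\<in>?C. path_monomial t (i + r) ^ N = \<alpha> * f + \<beta> * g"
    using s(1) by (auto simp: path_monomial_eq_string)
  have gens: "path_monomial t (i + r) \<in> (path_monomials t n :: 'k mpoly set)" if "r \<le> s" for r
    using that i s by (auto simp: path_monomials_def)
  have idI: "subring_ideal ?C ?I"
    using genideal_ideal[OF path_monomials_carrier] ideal_mpoly_ring_iff by blast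
  have fgI: "f \<in> ?I \<and> g \<in> ?I"
    using genideal_self[OF path_monomials_carrier] gens by (intro sub idI) blast
  have fgC: "{f, g} \<subseteq> ?C" using fg by simp
  have "path_monomial t (i + r) \<in> radical (mpoly_ring n) (Idl\<^bsub>mpoly_ring n\<^esub> {f, g})" if r: "r \<le> s" for r
  proof -
    obtain N \<alpha> \<beta> where "\<alpha> \<in> ?C" "\<beta> \<in> ?C" "path_monomial t (i + r) ^ N = \<alpha> * f + \<beta> * g"
      using rad[OF r] by blast
    moreover have "subring_ideal ?C (Idl\<^bsub>mpoly_ring n\<^esub> {f, g})"
      using genideal_ideal[OF fgC] ideal_mpoly_ring_iff by blast
    ultimately have "path_monomial t (i + r) ^ N \<in> Idl\<^bsub>mpoly_ring n\<^esub> {f, g}"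
      using genideal_self[OF fgC] by (simp add: subring_ideal_def)
    then show ?thesis
      using gens[OF r] path_monomials_carrier by (auto simp: radical_mpoly_ring)
  qed
  then show ?thesis
    using fgI by (intro exI[of _ "{f, g}"]) (auto simp: card_insert_if)
qed

text \<open>The first \<open>k (t + 1)\<close> path monomials are cut into \<open>k\<close> runs of length at most \<open>t + 1\<close>, each of which
  costs two elements; the remaining ones are taken as they are. Runs that reach beyond the last
  path monomial are shortened or empty.\<close>
lemma path_ideal_generators_up_to_radical:
  "\<exists>S :: 'k::comm_ring_1 mpoly set. S \<subseteq> carrier (mpoly_ring n) \<and> finite S \<and>
    card S \<le> 2 * k + (n + 1 - t - k * (t + 1)) \<and>
    radical (mpoly_ring n) (Idl\<^bsub>mpoly_ring n\<^esub> S) = radical (mpoly_ring n) (path_ideal t n)"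
proof -
  interpret cring "mpoly_ring n :: 'k mpoly ring" by (rule cring_mpoly_ring)
  let ?I = "Idl\<^bsub>mpoly_ring n\<^esub> (path_monomials t n) :: 'k mpoly set"
  let ?rad = "\<lambda>S :: 'k mpoly set. radical (mpoly_ring n) (Idl\<^bsub>mpoly_ring n\<^esub> S)"
  have "\<exists>S \<subseteq> ?I. finite S \<and> card S \<le> 2 \<and>
      (\<forall>i. q * (t + 1) < i \<and> i \<le> (q + 1) * (t + 1) \<and> i + t \<le> n + 1 \<longrightarrow> path_monomial t i \<in> ?rad S)" for q
  proof (cases "q * (t + 1) + 1 + t \<le> n + 1")
    case True
    define i0 where "i0 = q * (t + 1) + 1"
    define s where "s = min t (n + 1 - (i0 + t))"
    have "1 \<le> i0" "s \<le> t" "i0 + s + t \<le> n + 1"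
      using True by (auto simp: i0_def s_def)
    from consecutive_two_elements[OF this] obtain S :: "'k mpoly set"
      where S: "S \<subseteq> ?I" "finite S" "card S \<le> 2" "\<forall>r\<le>s. path_monomial t (i0 + r) \<in> ?rad S"
      by blast
    have "path_monomial t i \<in> ?rad S"
      if "q * (t + 1) < i" "i \<le> (q + 1) * (t + 1)" "i + t \<le> n + 1" for i
    proof -
      have "i = i0 + (i - i0)" "i - i0 \<le> s" using that by (auto simp: i0_def s_def)
      then show ?thesis using S(4) by metis
    qed
    then show ?thesis using S by blast
  next
    case False
    then show ?thesis by (intro exI[of _ "{}"]) auto
  qed
  then obtain S where S: "\<And>q. S q \<subseteq> ?I" "\<And>q. finite (S q)" "\<And>q. card (S q) \<le> 2"
    "\<And>q i. q * (t + 1) < i \<Longrightarrow> i \<le> (q + 1) * (t + 1) \<Longrightarrow> i + t \<le> n + 1 \<Longrightarrow> path_monomial t i \<in> ?rad (S q)"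
    by metis
  define E where "E = (path_monomial t ` {k * (t + 1)<..n + 1 - t} :: 'k mpoly set)"
  define T where "T = (\<Union>q<k. S q) \<union> (E \<inter> path_monomials t n)"
  have IC: "?I \<subseteq> carrier (mpoly_ring n)"
    using genideal_ideal[OF path_monomials_carrier] by (simp add: ideal_mpoly_ring_iff subring_ideal_def)
  have TI: "T \<subseteq> ?I"
    using S(1) genideal_self[OF path_monomials_carrier] by (auto simp: T_def)
  have "card (\<Union>q<k. S q) \<le> (\<Sum>q<k. 2)"
    using S(3) by (intro order_trans[OF card_UN_le] sum_mono) auto
  moreover have "card (E \<inter> path_monomials t n) \<le> card {k * (t + 1)<..n + 1 - t}"
    unfolding E_def by (intro order_trans[OF card_mono card_image_le]) auto
  ultimately have card: "card T \<le> 2 * k + (n + 1 - t - k * (t + 1))"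
    unfolding T_def by (intro order_trans[OF card_Un_le]) simp
  have fin: "finite T"
    using S(2) by (auto simp: T_def E_def)
  have mono: "?rad A \<subseteq> ?rad T" if "A \<subseteq> T" for A
  proof -
    have "Idl\<^bsub>mpoly_ring n\<^esub> A \<subseteq> Idl\<^bsub>mpoly_ring n\<^esub> T"
      using subset_Idl_subset[of T A] that TI IC by blast
    then show ?thesis by (auto simp: radical_mpoly_ring)
  qed
  have "path_monomials t n \<subseteq> ?rad T"
  proof
    fix p :: "'k mpoly" assume p: "p \<in> path_monomials t n"
    then obtain i where i: "p = path_monomial t i" "1 \<le> i" "i + t \<le> n + 1"
      by (auto simp: path_monomials_def)
    show "p \<in> ?rad T"
    proof (cases "i \<le> k * (t + 1)")
      case True
      define q where "q = (i - 1) div (t + 1)"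
      have "i - 1 = q * (t + 1) + (i - 1) mod (t + 1)"
        by (simp only: q_def div_mult_mod_eq)
      moreover have "(i - 1) mod (t + 1) < t + 1" by (rule mod_less_divisor) simp
      ultimately have "q * (t + 1) < i" "i \<le> q * (t + 1) + (t + 1)"
        using i(2) by linarith+
      then have qi: "q * (t + 1) < i" "i \<le> (q + 1) * (t + 1)" by (simp_all add: add_mult_distrib)
      have "q < k"
        using qi(1) True by (metis less_le_trans mult_less_cancel2)
      then have "S q \<subseteq> T" by (auto simp: T_def)
      then show ?thesis
        using mono S(4)[OF qi i(3)] i(1) by blast
    next
      case False
      then have "p \<in> T"
        using i p by (auto simp: T_def E_def)
      moreover have TC: "T \<subseteq> carrier (mpoly_ring n)" using TI IC by blast
      ultimately have "p \<in> Idl\<^bsub>mpoly_ring n\<^esub> T" using genideal_self[of T] by blast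
      then show ?thesis
        using subset_radical[of "Idl\<^bsub>mpoly_ring n\<^esub> T" n] genideal_ideal[OF TC]
        by (auto simp: ideal_mpoly_ring_iff subring_ideal_def)
    qed
  qed
  then have "?rad T = ?rad (path_monomials t n)"
    using TI IC by (intro radical_eqI path_monomials_carrier) auto
  then show ?thesis
    using TI IC fin card by (intro exI[of _ T]) (auto simp: path_ideal_eq)
qed

lemma specialize_path_monomial:
  "specialize Y (path_monomial t i) = (\<Prod>j\<in>{i..<i + t} \<inter> Y. var j)"
  by (simp add: path_monomial_def specialize_prod specialize_var prod.If_cases)

lemma lookup_prod_var_zero:
  assumes "finite A" "A \<noteq> {}"
  shows "Poly_Mapping.lookup (\<Prod>j\<in>A. var j :: 'k::comm_ring_1 mpoly) 0 = 0"
proof -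
  obtain j B where A: "A = insert j B" "j \<notin> B" "finite B"
    using assms by (metis finite_insert mk_disjoint_insert all_not_in_conv)
  have "(Poly_Mapping.single j 1 :: nat \<Rightarrow>\<^sub>0 nat) \<noteq> 0"
    by (metis lookup_single_eq lookup_zero zero_neq_one)
  then have "Poly_Mapping.lookup (var j :: 'k mpoly) 0 = 0"
    by (simp add: var_def lookup_single when_def)
  then show ?thesis
    using A by (simp add: lookup_mult_zero)
qed

text \<open>Specialize to the variables whose index is congruent to \<open>0\<close> or \<open>1\<close> modulo \<open>t + 1\<close>, without the index
  \<open>k (t + 1) + 1\<close> when \<open>d < t\<close>. A window of \<open>t\<close> consecutive indices misses only one residue class,
  so it meets these indices. If it starts in the residue class \<open>1\<close> or \<open>2\<close>, it avoids the class \<open>0\<close> or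
  \<open>1\<close>, respectively, and meets them in a single index. The index \<open>k (t + 1) + 1\<close> has to be left out for \<open>d < t\<close>
  because no window starting there fits; a window through it that starts earlier contains its
  neighbour \<open>k (t + 1)\<close>.\<close>
lemma card_le_generators_of_path_ideal:
  fixes S :: "'k::field mpoly set"
  assumes t: "0 < t" and n: "n = k * (t + 1) + d" "d \<le> t"
    and S: "S \<subseteq> carrier (mpoly_ring n)" "finite S"
    and rad: "radical (mpoly_ring n) (Idl\<^bsub>mpoly_ring n\<^esub> S) = radical (mpoly_ring n) (path_ideal t n)"
  shows "2 * k + (if d = t then 1 else 0) \<le> card S"
proof -
  \<comment> \<open>\<open>L\<close> and \<open>R\<close> contain the first and last indices of the \<open>k\<close> blocks of length \<open>t + 1\<close>. The
    remaining \<open>d\<close> indices contribute their first one to \<open>L\<close> if they are enough for a window.\<close>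
  define e where "e = (if d = t then 1 else 0 :: nat)"
  define L where "L = (\<lambda>j. j * (t + 1) + 1) ` {..<k + e}"
  define R where "R = (\<lambda>j. (j + 1) * (t + 1)) ` {..<k}"
  have Lmod: "y mod (t + 1) = 1" if y: "y \<in> L" for y
  proof -
    obtain l where "y = l * (t + 1) + 1" using y by (auto simp: L_def)
    then have "y mod (t + 1) = 1 mod (t + 1)" by (simp only: mod_mult_self3)
    then show ?thesis using t by simp
  qed
  have Rmod: "y mod (t + 1) = 0" if y: "y \<in> R" for y
  proof -
    obtain l where "y = (l + 1) * (t + 1)" using y by (auto simp: R_def)
    then show ?thesis by (simp only: mod_mult_self2_is_0)
  qed
  have disj: "L \<inter> R = {}"
    using Lmod Rmod by fastforce
  have "inj_on (\<lambda>j. j * (t + 1) + 1) {..<k + e}" "inj_on (\<lambda>j. (j + 1) * (t + 1)) {..<k}"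
    by (auto simp only: inj_on_def add_right_cancel mult_cancel2)
  then have "card L = k + e" "card R = k"
    unfolding L_def R_def by (simp_all only: card_image card_lessThan)
  then have cardY: "card (L \<union> R) = 2 * k + e"
    using disj by (subst card_Un_disjoint) (auto simp: L_def R_def)
  have e: "e * t \<le> d" "d < t \<Longrightarrow> e = 0"
    using n(2) by (auto simp: e_def)
  have "card (L \<union> R) \<le> card S"
  proof (rule card_le_of_specialized_variables[OF S(2,1) path_monomials_carrier])
    show "radical (mpoly_ring n) (Idl\<^bsub>mpoly_ring n\<^esub> S)
        = radical (mpoly_ring n) (Idl\<^bsub>mpoly_ring n\<^esub> (path_monomials t n))"
      using rad by (simp add: path_ideal_eq)
    show "finite (L \<union> R)" by (simp add: L_def R_def)
  next
    fix g :: "'k mpoly" assume "g \<in> path_monomials t n"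
    then obtain i where i: "g = path_monomial t i" "1 \<le> i" "i + t \<le> n + 1"
      by (auto simp: path_monomials_def)
    define j r where "j = (i - 1) div (t + 1)" and "r = (i - 1) mod (t + 1)"
    have ijr: "i = j * (t + 1) + r + 1" "r \<le> t"
      using i(2) div_mult_mod_eq[of "i - 1" "t + 1"] mod_less_divisor[of "t + 1" "i - 1"]
      unfolding j_def r_def by linarith+
    have "{i..<i + t} \<inter> (L \<union> R) \<noteq> {}"
    proof (cases "r = 0")
      case True
      have "j < k + e"
      proof (rule ccontr)
        assume "\<not> j < k + e"
        then have "(k + e) * (t + 1) \<le> j * (t + 1)" by (intro mult_right_mono) auto
        then have "k * (t + 1) + e * t + e + t \<le> k * (t + 1) + d"
          using i(3) n(1) ijr(1) True by (simp add: algebra_simps)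
        then show False using n(2) e t by (auto simp: e_def split: if_splits)
      qed
      then have "i \<in> L" using ijr True by (auto simp: L_def)
      moreover have "i \<in> {i..<i + t}" using t by simp
      ultimately show ?thesis by blast
    next
      case False
      have "j < k"
      proof (rule ccontr)
        assume "\<not> j < k"
        then have "k * (t + 1) \<le> j * (t + 1)" by (intro mult_right_mono) auto
        then show False using i(3) n ijr(1) False by linarith
      qed
      then have "(j + 1) * (t + 1) \<in> R" by (auto simp: R_def)
      moreover have "(j + 1) * (t + 1) \<in> {i..<i + t}" using ijr False by (auto simp: algebra_simps)
      ultimately show ?thesis by blast
    qed
    then show "Poly_Mapping.lookup (specialize (L \<union> R) g) 0 = 0"
      by (simp only: i(1) specialize_path_monomial) (rule lookup_prod_var_zero, auto)
  next
    \<comment> \<open>Two members of a residue class are not closer than \<open>t + 1\<close>.\<close>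
    have mod_between: False if "y mod (t + 1) = c" "l * (t + 1) + c < y" "y < (l + 1) * (t + 1) + c" for y c l
    proof -
      have "c < t + 1" using that(1) mod_less_divisor[of "t + 1" y] by simp
      then have "(y - c) div (t + 1) * (t + 1) = y - c"
        using that(1) by (metis dvd_div_mult_self dvd_minus_mod)
      then have eq: "y = (y - c) div (t + 1) * (t + 1) + c"
        using that(1,2) by linarith
      have "l < (y - c) div (t + 1)"
        using that(2) eq by (metis add_less_cancel_right mult_less_cancel2)
      moreover have "(y - c) div (t + 1) < l + 1"
        using that(3) eq by (metis add_less_cancel_right mult_less_cancel2)
      ultimately show False by simp
    qed
    fix y assume "y \<in> L \<union> R"
    then show "\<exists>g\<in>path_monomials t n. specialize (L \<union> R) g = (var y :: 'k mpoly)"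
    proof
      assume yL: "y \<in> L"
      then obtain l where l: "y = l * (t + 1) + 1" "l < k + e" by (auto simp: L_def)
      have "{y..<y + t} \<inter> (L \<union> R) = {y}"
      proof -
        have "z = y" if "z \<in> {y..<y + t}" "z \<in> L \<union> R" for z
        proof (rule ccontr)
          assume "z \<noteq> y"
          then have "l * (t + 1) + 1 < z" "z < (l + 1) * (t + 1)"
            using that(1) l(1) by auto
          then show False
            using that(2) mod_between[of z 1 l] mod_between[of z 0 l] Lmod[of z] Rmod[of z] by auto
        qed
        then show ?thesis using yL t by auto
      qed
      moreover have "y + t \<le> n + 1"
      proof -
        have "(l + 1) * (t + 1) \<le> (k + e) * (t + 1)" using l(2) by (intro mult_right_mono) auto
        moreover have "e * (t + 1) \<le> d + 1" using e by (auto simp: e_def)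
        ultimately show ?thesis using l(1) n(1) by (simp add: algebra_simps)
      qed
      ultimately show ?thesis
        using l(1) by (intro bexI[of _ "path_monomial t y"])
          (auto simp: specialize_path_monomial path_monomials_def)
    next
      assume yR: "y \<in> R"
      then obtain l where l: "y = (l + 1) * (t + 1)" "l < k" by (auto simp: R_def)
      define i where "i = l * (t + 1) + 2"
      have i: "y = i + t - 1" by (simp add: l(1) i_def)
      have "{i..<i + t} \<inter> (L \<union> R) = {y}"
      proof -
        have "z = y" if "z \<in> {i..<i + t}" "z \<in> L \<union> R" for z
        proof (rule ccontr)
          assume "z \<noteq> y"
          then have "l * (t + 1) + 1 < z" "z < (l + 1) * (t + 1)"
            using that(1) i l(1) by (auto simp: i_def)
          then show False
            using that(2) mod_between[of z 1 l] mod_between[of z 0 l] Lmod[of z] Rmod[of z] by auto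
        qed
        then show ?thesis using yR t i by auto
      qed
      moreover have "i + t \<le> n + 1"
      proof -
        have "(l + 1) * (t + 1) \<le> k * (t + 1)" using l(2) by (intro mult_right_mono) auto
        then show ?thesis using n(1) by (simp add: i_def)
      qed
      ultimately show ?thesis
        by (intro bexI[of _ "path_monomial t i"])
          (auto simp: specialize_path_monomial path_monomials_def i_def)
    qed
  qed
  then show ?thesis by (simp add: cardY e_def)
qed

lemma arithmetical_rank_path_ideal:
  assumes t: "0 < t" and n: "n = k * (t + 1) + d" "d \<le> t"
  shows "arithmetical_rank (mpoly_ring n) (path_ideal t n :: 'k::field mpoly set)
    = 2 * k + (if d = t then 1 else 0)"
proof -
  let ?P = "\<lambda>m. \<exists>S \<subseteq> carrier (mpoly_ring n). finite S \<and> card S = m \<and>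
    radical (mpoly_ring n) (Idl\<^bsub>mpoly_ring n\<^esub> S) = radical (mpoly_ring n) (path_ideal t n :: 'k mpoly set)"
  obtain S :: "'k mpoly set" where S: "S \<subseteq> carrier (mpoly_ring n)" "finite S"
      "card S \<le> 2 * k + (n + 1 - t - k * (t + 1))"
      "radical (mpoly_ring n) (Idl\<^bsub>mpoly_ring n\<^esub> S) = radical (mpoly_ring n) (path_ideal t n)"
    using path_ideal_generators_up_to_radical[of n k t] by blast
  have lower: "2 * k + (if d = t then 1 else 0) \<le> m" if "?P m" for m
    using that card_le_generators_of_path_ideal[OF t n] by blast
  have "n + 1 - t - k * (t + 1) = (if d = t then 1 else 0)"
    using n by auto
  moreover have "?P (card S)"
    using S(1,2,4) by blast
  ultimately have "card S = 2 * k + (if d = t then 1 else 0)"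
    using S(3) lower[of "card S"] by (intro antisym) simp_all
  then show ?thesis
    unfolding arithmetical_rank_def using S lower by (intro Least_equality) blast+
qed

theorem corollary1:
  fixes t n :: nat
  assumes "t > 0" and "n > 0"
  shows "(\<forall>d. 0 \<le> d \<and> d \<le> t - 1 \<and> [n = d] (mod (t + 1)) \<longrightarrow>
            real (arithmetical_rank (mpoly_ring n) (path_ideal t n :: 'k::field mpoly set))
              = 2 * (real n - real d) / (real t + 1))
       \<and> ([n = t] (mod (t + 1)) \<longrightarrow>
            real (arithmetical_rank (mpoly_ring n) (path_ideal t n :: 'k::field mpoly set))
              = (2 * real n - (real t - 1)) / (real t + 1))"
proof (intro conjI allI impI)
  have decomp: "n = n div (t + 1) * (t + 1) + d" if "[n = d] (mod (t + 1))" "d \<le> t" for d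
    using that div_mult_mod_eq[of n "t + 1"] by (simp add: cong_def)
  fix d assume d: "0 \<le> d \<and> d \<le> t - 1 \<and> [n = d] (mod (t + 1))"
  then have "d \<le> t" "d \<noteq> t" using assms(1) by auto
  with decomp[of d] d obtain k where k: "n = k * (t + 1) + d" by blast
  have "arithmetical_rank (mpoly_ring n) (path_ideal t n :: 'k mpoly set) = 2 * k"
    using arithmetical_rank_path_ideal[OF assms(1) k \<open>d \<le> t\<close>] \<open>d \<noteq> t\<close> by simp
  moreover have "real n - real d = real k * (real t + 1)"
    by (simp add: k algebra_simps)
  ultimately show "real (arithmetical_rank (mpoly_ring n) (path_ideal t n :: 'k mpoly set))
      = 2 * (real n - real d) / (real t + 1)"
    by simp
next
  assume "[n = t] (mod (t + 1))"
  then have "n = n div (t + 1) * (t + 1) + t"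
    using div_mult_mod_eq[of n "t + 1"] by (simp add: cong_def)
  then obtain k where k: "n = k * (t + 1) + t" by blast
  have "arithmetical_rank (mpoly_ring n) (path_ideal t n :: 'k mpoly set) = 2 * k + 1"
    using arithmetical_rank_path_ideal[OF assms(1) k] by simp
  moreover have "2 * real n - (real t - 1) = (2 * real k + 1) * (real t + 1)"
    by (simp add: k algebra_simps)
  ultimately show "real (arithmetical_rank (mpoly_ring n) (path_ideal t n :: 'k mpoly set))
      = (2 * real n - (real t - 1)) / (real t + 1)"
    by simp
qed

end
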